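(* Let $n\ge1$, let $\alpha>0$, and let $\mathcal{D}$ be a probability distribution over $S_n$. If $\mathcal{D}$ is backwards $\alpha$-efficient, then $\mathrm{H}(\mathcal{D})\ge\left\lfloor \frac{n}{48\alpha}\right\rfloor$.
   Context: $[n]=\{1,\dots,n\}$ and $S_n$ is the set of permutations of $[n]$. A permutation $\pi\in S_n$ is viewed as the ordering $(\pi(1),\dots,\pi(n))$; for $I\subseteq[n]$, $\pi(I)=\{\pi(j):j\in I\}$ and $[i]=\{1,\dots,i\}$. A cost function over $[n]$ assigns a real number $c(x,Y)$ to every $Y\subseteq[n]$ and $x\in Y$; the total cost of $\pi$ is $c(\pi)=\sum_{i=1}^n c(\pi(i),\pi([i]))$. $\mathcal{D}$ is backwards $\alpha$-efficient if for every cost function $c$ such that $\mathbb{E}_{x\sim\mathcal{U}(Y)}[c(x,Y)]\le1$ for every nonempty $Y\subseteq[n]$ ($\mathcal{U}(Y)$ the uniform distribution on $Y$), we have $\mathbb{E}_{\pi\sim\mathcal{D}}[c(\pi)]\le\alpha n$. $\mathrm{H}(\mathcal{D})=-\sum_{\pi}\Pr_{\mathcal{D}}[\pi]\ln\Pr_{\mathcal{D}}[\pi]$ is the (natural-log) entropy of $\mathcal{D}$. *)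

theory Defs
  imports "HOL-Probability.Probability" "HOL-Combinatorics.Permutations"
begin

text \<open>
  A permutation of \<open>[n]\<close> is a function \<open>\<pi>\<close> with \<open>\<pi> permutes {1..n}\<close>, and a distribution over \<open>S\<^sub>n\<close>
  is a pmf supported on these. A cost function is a total function \<open>c\<close>, of which only the values
  \<open>c x Y\<close> with \<open>x \<in> Y \<subseteq> {1..n}\<close> are ever used; costs may be negative.
\<close>

definition total_cost :: "nat \<Rightarrow> (nat \<Rightarrow> nat set \<Rightarrow> real) \<Rightarrow> (nat \<Rightarrow> nat) \<Rightarrow> real" where
  "total_cost n c \<pi> = (\<Sum>i=1..n. c (\<pi> i) (\<pi> ` {1..i}))"

definition backwards_efficient :: "nat \<Rightarrow> real \<Rightarrow> (nat \<Rightarrow> nat) pmf \<Rightarrow> bool" where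
  "backwards_efficient n \<alpha> D \<longleftrightarrow>
     (\<forall>c :: nat \<Rightarrow> nat set \<Rightarrow> real.
        (\<forall>Y. Y \<subseteq> {1..n} \<and> Y \<noteq> {} \<longrightarrow> measure_pmf.expectation (pmf_of_set Y) (\<lambda>x. c x Y) \<le> 1) \<longrightarrow>
        measure_pmf.expectation D (total_cost n c) \<le> \<alpha> * real n)"

text \<open>The convention \<open>0 \<cdot> ln 0 = 0\<close> holds automatically.\<close>

definition perm_entropy :: "nat \<Rightarrow> (nat \<Rightarrow> nat) pmf \<Rightarrow> real" where
  "perm_entropy n D = - (\<Sum>\<pi> | \<pi> permutes {1..n}. pmf D \<pi> * ln (pmf D \<pi>))"

end

theory Submission imports Defs begin

text \<open>
  Let \<open>q i x Y\<close> be the conditional probability that \<open>\<pi> i = x\<close> given \<open>\<pi>[i] = Y\<close>. The cost function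
  \<open>c x Y = |Y| \<cdot> q |Y| x Y\<close> is admissible, so efficiency gives
  \<open>(\<Sum>i. i \<cdot> E[q i (\<pi> i) \<pi>[i]]) \<le> \<alpha> n\<close>. By averaging over the upper half of the positions there is
  a window \<open>{N-k<..N}\<close> of length \<open>k = \<lfloor>n / (48 \<alpha>)\<rfloor>\<close> on which these expectations sum to at most \<open>1/3\<close>.

  Extend \<open>\<pi>[N]\<close> downwards by the Markov chain with kernel \<open>q\<close>: its sets have the same marginals as
  the \<open>\<pi>[i]\<close>, and a path of length \<open>k\<close> is determined by its endpoints up to \<open>k!\<close> choices, so that
  \<open>H(\<pi>[N-k]) \<ge> (\<Sum>i. E[- ln q]) - ln k!\<close>, which is at least \<open>k\<close>. This estimate is obtained one
  step at a time from Gibbs' inequality, with the potential \<open>E[ln (F \<pi>[i] / f \<pi>[i])]\<close>, where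
  \<open>F Y\<close> is the probability that \<open>Y \<subseteq> \<pi>[N]\<close> and \<open>f Y\<close> the probability that \<open>Y = \<pi>[i]\<close>.
\<close>

lemma ln_le_tangent:
  fixes x c :: real
  assumes "x > 0"
  shows "ln x \<le> exp c * x - c - 1"
proof -
  have "ln (exp c * x) \<le> exp c * x - 1"
    using assms by (intro ln_le_minus_one) simp
  then show ?thesis
    using assms by (simp add: ln_mult)
qed

lemma expectation_pmf_cong:
  fixes p :: "'a pmf" and f g :: "'a \<Rightarrow> real"
  assumes "\<And>x. x \<in> set_pmf p \<Longrightarrow> f x = g x"
  shows "measure_pmf.expectation p f = measure_pmf.expectation p g"
  by (rule integral_cong_AE) (use assms in \<open>auto simp: AE_measure_pmf_iff\<close>)

lemma expectation_pmf_mono: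
  fixes p :: "'a pmf" and f g :: "'a \<Rightarrow> real"
  assumes "finite (set_pmf p)" and "\<And>x. x \<in> set_pmf p \<Longrightarrow> f x \<le> g x"
  shows "measure_pmf.expectation p f \<le> measure_pmf.expectation p g"
  by (rule integral_mono_AE)
     (use assms in \<open>auto simp: AE_measure_pmf_iff integrable_measure_pmf_finite\<close>)

lemma gibbs_inequality_pmf:
  fixes p :: "'a pmf" and g :: "'a \<Rightarrow> real"
  assumes fin: "finite (set_pmf p)"
    and pos: "\<And>z. z \<in> set_pmf p \<Longrightarrow> g z > 0"
    and sum_le: "sum g (set_pmf p) \<le> 1"
  shows "measure_pmf.expectation p (\<lambda>z. ln (g z)) \<le> measure_pmf.expectation p (\<lambda>z. ln (pmf p z))"
proof -
  have pointwise: "pmf p z * ln (g z) - pmf p z * ln (pmf p z) \<le> g z - pmf p z"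
    if "z \<in> set_pmf p" for z
  proof -
    have "pmf p z > 0" and "g z > 0"
      using that pos by (simp_all add: pmf_positive)
    moreover from this have "ln (g z / pmf p z) \<le> g z / pmf p z - 1"
      by (intro ln_le_minus_one) simp
    ultimately have "pmf p z * (ln (g z) - ln (pmf p z)) \<le> pmf p z * (g z / pmf p z - 1)"
      by (simp add: ln_div)
    also have "\<dots> = g z - pmf p z"
      using \<open>pmf p z > 0\<close> by (simp add: field_simps)
    finally show ?thesis
      by (simp add: right_diff_distrib)
  qed
  have expectation_eq: "measure_pmf.expectation p h = (\<Sum>z\<in>set_pmf p. pmf p z * h z)"
    for h :: "'a \<Rightarrow> real"
    using integral_measure_pmf_real[OF fin, of p h] by (simp add: mult.commute)
  have "measure_pmf.expectation p (\<lambda>z. ln (g z)) - measure_pmf.expectation p (\<lambda>z. ln (pmf p z))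
      \<le> (\<Sum>z\<in>set_pmf p. g z - pmf p z)"
    unfolding expectation_eq sum_subtractf[symmetric] by (rule sum_mono) (rule pointwise)
  also have "\<dots> = sum g (set_pmf p) - 1"
    by (simp add: sum_subtractf sum_pmf_eq_1[OF fin])
  finally show ?thesis
    using sum_le by simp
qed

lemma sum_cond_prob_le_1:
  fixes p :: "'a pmf" and X :: "'a \<Rightarrow> 'b"
  assumes "finite A"
  shows "(\<Sum>x\<in>A. \<P>(\<omega> in p. X \<omega> = x \<bar> Q \<omega>)) \<le> 1"
proof -
  have "(\<Sum>x\<in>A. measure p {\<omega>. X \<omega> = x \<and> Q \<omega>}) = measure p (\<Union>x\<in>A. {\<omega>. X \<omega> = x \<and> Q \<omega>})"
    by (rule measure_pmf.finite_measure_finite_Union[symmetric])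
       (use assms in \<open>auto simp: disjoint_family_on_def\<close>)
  also have "\<dots> \<le> measure p {\<omega>. Q \<omega>}"
    by (rule measure_pmf.finite_measure_mono) auto
  finally show ?thesis
    by (simp add: cond_prob_def sum_divide_distrib[symmetric] divide_le_eq_1)
       (use measure_nonneg[of p "{\<omega>. Q \<omega>}"] in linarith)
qed

lemma sum_prob_insert_subset:
  fixes p :: "'a pmf" and T :: "'a \<Rightarrow> 'b set"
  assumes "finite U" and "Y \<subseteq> U"
    and subset_card: "\<And>\<omega>. \<omega> \<in> set_pmf p \<Longrightarrow> T \<omega> \<subseteq> U \<and> card (T \<omega>) = N"
  shows "(\<Sum>x\<in>U - Y. \<P>(\<omega> in p. insert x Y \<subseteq> T \<omega>))
    = (real N - real (card Y)) * \<P>(\<omega> in p. Y \<subseteq> T \<omega>)"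
proof -
  have count: "(\<Sum>x\<in>U - Y. indicator {\<omega>. insert x Y \<subseteq> T \<omega>} \<omega>)
      = (real N - real (card Y)) * indicator {\<omega>. Y \<subseteq> T \<omega>} \<omega>"
    if "\<omega> \<in> set_pmf p" for \<omega>
  proof (cases "Y \<subseteq> T \<omega>")
    case True
    have "(\<Sum>x\<in>U - Y. indicator {\<omega>. insert x Y \<subseteq> T \<omega>} \<omega>) = (\<Sum>x\<in>U - Y. of_bool (x \<in> T \<omega>) :: real)"
      using True by (intro sum.cong) auto
    also have "\<dots> = real (card ((U - Y) \<inter> T \<omega>))"
      using assms(1) by (simp add: Int_def)
    also have "(U - Y) \<inter> T \<omega> = T \<omega> - Y"
      using subset_card[OF that] by blast
    also have "real (card (T \<omega> - Y)) = real N - real (card Y)"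
      using subset_card[OF that] True assms(1)
      by (metis card_Diff_subset card_mono finite_subset of_nat_diff)
    finally show ?thesis
      using True by simp
  qed auto
  have "(\<Sum>x\<in>U - Y. \<P>(\<omega> in p. insert x Y \<subseteq> T \<omega>))
      = measure_pmf.expectation p (\<lambda>\<omega>. \<Sum>x\<in>U - Y. indicator {\<omega>. insert x Y \<subseteq> T \<omega>} \<omega>)"
    by (subst Bochner_Integration.integral_sum)
       (simp_all add: measure_pmf.integrable_const_bound[where B = 1])
  also have "\<dots> = measure_pmf.expectation p
      (\<lambda>\<omega>. (real N - real (card Y)) * indicator {\<omega>. Y \<subseteq> T \<omega>} \<omega>)"
    by (rule expectation_pmf_cong) (rule count)
  finally show ?thesis
    by simp
qed

lemma exists_block_sum_le:
  fixes a :: "nat \<Rightarrow> real"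
  assumes "(\<Sum>j\<in>{m<..m + W * k}. a j) \<le> real W * c" and "W > 0"
  shows "\<exists>i. m \<le> i \<and> i + k \<le> m + W * k \<and> (\<Sum>j\<in>{i<..i + k}. a j) \<le> c"
  using assms(2,1)
proof (induction W arbitrary: m rule: nat_induct_non_zero)
  case 1
  then show ?case by (intro exI[of _ m]) simp
next
  case (Suc W)
  show ?case
  proof (cases "(\<Sum>j\<in>{m<..m + k}. a j) \<le> c")
    case True
    then show ?thesis by (intro exI[of _ m]) simp
  next
    case False
    have "{m<..m + Suc W * k} = {m<..m + k} \<union> {m + k<..m + k + W * k}"
      by auto
    then have "(\<Sum>j\<in>{m<..m + Suc W * k}. a j)
        = (\<Sum>j\<in>{m<..m + k}. a j) + (\<Sum>j\<in>{m + k<..m + k + W * k}. a j)"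
      by (simp add: sum.union_disjoint)
    then have "(\<Sum>j\<in>{m + k<..m + k + W * k}. a j) \<le> real W * c"
      using False Suc.prems by (simp add: algebra_simps)
    then obtain i where "m + k \<le> i" "i + k \<le> m + k + W * k" "(\<Sum>j\<in>{i<..i + k}. a j) \<le> c"
      using Suc.IH by blast
    then show ?thesis
      by (intro exI[of _ i]) simp
  qed
qed

lemma sum_upper_half_le:
  fixes a :: "nat \<Rightarrow> real"
  assumes nonneg: "\<And>i. a i \<ge> 0"
    and weighted: "(\<Sum>i=1..n. real i * a i) \<le> s * real n" and "n > 0"
  shows "(\<Sum>i\<in>{n div 2<..n}. a i) \<le> 2 * s"
proof -
  have "real n / 2 * (\<Sum>i\<in>{n div 2<..n}. a i) \<le> (\<Sum>i\<in>{n div 2<..n}. real i * a i)"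
    unfolding sum_distrib_left by (intro sum_mono mult_right_mono nonneg) auto
  also have "\<dots> \<le> (\<Sum>i=1..n. real i * a i)"
    by (rule sum_mono2) (auto simp: nonneg)
  also have "\<dots> \<le> real n / 2 * (2 * s)"
    using weighted by (simp add: mult.commute)
  finally show ?thesis
    using \<open>n > 0\<close> by simp
qed

lemma exists_light_window:
  fixes a :: "nat \<Rightarrow> real"
  assumes nonneg: "\<And>i. a i \<ge> 0"
    and weighted: "(\<Sum>i=1..n. real i * a i) \<le> s * real n"
    and k_pos: "k > 0" and k_le: "4 * k \<le> n"
  shows "\<exists>i. i + k \<le> n \<and> real n * (\<Sum>j\<in>{i<..i + k}. a j) \<le> 8 * real k * s"
proof -
  define W where "W = (n - n div 2) div k"
  have "W * k + (n - n div 2) mod k = n - n div 2" and "(n - n div 2) mod k < k"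
    using k_pos k_le by (simp_all add: W_def)
  then have W_bounds: "n div 2 + W * k \<le> n" "n \<le> 4 * (W * k)"
    using k_le by linarith+
  then have "W > 0"
    using k_pos k_le by (intro gr0I) auto
  have "0 \<le> (\<Sum>i\<in>{n div 2<..n}. a i)"
    by (simp add: sum_nonneg nonneg)
  also have upper_half: "\<dots> \<le> 2 * s"
    using k_pos k_le by (intro sum_upper_half_le nonneg weighted) auto
  finally have "s \<ge> 0" by simp
  have "(\<Sum>j\<in>{n div 2<..n div 2 + W * k}. a j) \<le> (\<Sum>i\<in>{n div 2<..n}. a i)"
    using W_bounds by (intro sum_mono2) (auto simp: nonneg)
  also note upper_half
  also have "2 * s \<le> real W * (8 * real k * s / real n)"
  proof -
    have "real n * s \<le> (4 * (real W * real k)) * s"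
      using W_bounds(2) \<open>s \<ge> 0\<close> by (intro mult_right_mono) (simp_all flip: of_nat_mult)
    then show ?thesis
      using k_pos k_le by (simp add: field_simps)
  qed
  finally obtain i where "i + k \<le> n div 2 + W * k" "(\<Sum>j\<in>{i<..i + k}. a j) \<le> 8 * real k * s / real n"
    using exists_block_sum_le[OF _ \<open>W > 0\<close>] by blast
  then show ?thesis
    using W_bounds k_pos k_le by (intro exI[of _ i]) (simp add: field_simps)
qed

definition prefix_set :: "nat \<Rightarrow> (nat \<Rightarrow> 'a) \<Rightarrow> 'a set" where
  "prefix_set i \<pi> = \<pi> ` {1..i}"

lemma prefix_set_Suc: "prefix_set (Suc i) \<pi> = insert (\<pi> (Suc i)) (prefix_set i \<pi>)"
  by (simp add: prefix_set_def atLeastAtMostSuc_conv)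

lemma backwards_efficient_imp_ge_1:
  assumes "n \<ge> 1" and "backwards_efficient n \<alpha> D"
  shows "\<alpha> \<ge> 1"
proof -
  have "measure_pmf.expectation D (total_cost n (\<lambda>_ _. 1)) \<le> \<alpha> * real n"
    using assms(2) unfolding backwards_efficient_def by simp
  then show ?thesis
    using assms(1) by (simp add: total_cost_def[abs_def])
qed

locale permutation_pmf =
  fixes n :: nat and D :: "(nat \<Rightarrow> nat) pmf"
  assumes support: "set_pmf D \<subseteq> {\<pi>. \<pi> permutes {1..n}}"
begin

abbreviation E :: "((nat \<Rightarrow> nat) \<Rightarrow> real) \<Rightarrow> real" where
  "E \<equiv> measure_pmf.expectation D"

lemma finite_support: "finite (set_pmf D)"
  using support finite_permutations[of "{1..n}"] finite_subset by blast

lemma integrable_D [simp]: "integrable (measure_pmf D) (h :: (nat \<Rightarrow> nat) \<Rightarrow> real)"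
  by (rule integrable_measure_pmf_finite[OF finite_support])

lemma inj_D: "\<pi> \<in> set_pmf D \<Longrightarrow> inj \<pi>"
  using support by (auto intro: permutes_inj)

lemma card_prefix_set: "\<pi> \<in> set_pmf D \<Longrightarrow> card (prefix_set i \<pi>) = i"
  by (simp add: prefix_set_def card_image inj_on_subset[OF inj_D])

lemma prefix_set_subset:
  assumes "\<pi> \<in> set_pmf D" and "i \<le> n"
  shows "prefix_set i \<pi> \<subseteq> {1..n}"
proof -
  have "\<pi> permutes {1..n}"
    using assms(1) support by auto
  then have "\<pi> ` {1..n} = {1..n}"
    by (rule permutes_image)
  then show ?thesis
    using assms(2) unfolding prefix_set_def
    by (metis atLeastatMost_subset_iff image_mono order_refl)
qed

lemma next_notin_prefix_set: "\<pi> \<in> set_pmf D \<Longrightarrow> \<pi> (Suc i) \<notin> prefix_set i \<pi>"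
  by (simp add: prefix_set_def inj_image_mem_iff[OF inj_D])

lemma next_in_range: "\<pi> \<in> set_pmf D \<Longrightarrow> i < n \<Longrightarrow> \<pi> (Suc i) \<in> {1..n}"
  using prefix_set_subset[of \<pi> "Suc i"] by (simp add: prefix_set_Suc)

definition prefix_prob :: "nat \<Rightarrow> nat set \<Rightarrow> real" where
  "prefix_prob i Y = \<P>(\<pi> in D. prefix_set i \<pi> = Y)"

definition last_prob :: "nat \<Rightarrow> nat \<Rightarrow> nat set \<Rightarrow> real" where
  "last_prob i x Y = \<P>(\<pi> in D. \<pi> i = x \<bar> prefix_set i \<pi> = Y)"

definition hit_prob :: "nat \<Rightarrow> real" where
  "hit_prob i = E (\<lambda>\<pi>. last_prob i (\<pi> i) (prefix_set i \<pi>))"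

definition cover_prob :: "nat \<Rightarrow> nat set \<Rightarrow> real" where
  "cover_prob N Y = \<P>(\<pi> in D. Y \<subseteq> prefix_set N \<pi>)"

definition potential :: "nat \<Rightarrow> nat \<Rightarrow> real" where
  "potential N i = E (\<lambda>\<pi>. ln (cover_prob N (prefix_set i \<pi>) / prefix_prob i (prefix_set i \<pi>)))"

lemma prefix_prob_pos: "\<pi> \<in> set_pmf D \<Longrightarrow> prefix_prob i (prefix_set i \<pi>) > 0"
  by (auto simp: prefix_prob_def intro: measure_pmf_posI)

lemma last_prob_pos: "\<pi> \<in> set_pmf D \<Longrightarrow> last_prob i (\<pi> i) (prefix_set i \<pi>) > 0"
  by (auto simp: last_prob_def cond_prob_def intro!: divide_pos_pos measure_pmf_posI)

lemma hit_prob_nonneg: "hit_prob i \<ge> 0"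
  by (simp add: hit_prob_def last_prob_def cond_prob_def)

lemma cover_prob_nonneg: "cover_prob N Y \<ge> 0"
  by (simp add: cover_prob_def)

lemma cover_prob_le_1: "cover_prob N Y \<le> 1"
  by (simp add: cover_prob_def)

lemma cover_prob_pos:
  assumes "\<pi> \<in> set_pmf D" and "i \<le> N"
  shows "cover_prob N (prefix_set i \<pi>) > 0"
  using assms by (auto simp: cover_prob_def prefix_set_def intro!: measure_pmf_posI)

lemma sum_prefix_prob: "(\<Sum>Y\<in>prefix_set i ` set_pmf D. prefix_prob i Y) = 1"
proof -
  have "prefix_prob i = pmf (map_pmf (prefix_set i) D)"
    by (auto simp: prefix_prob_def pmf_map vimage_def)
  then show ?thesis
    using finite_support by (simp add: sum_pmf_eq_1)
qed

lemma sum_cover_prob_insert: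
  assumes "N \<le> n" and "Y \<subseteq> {1..n}"
  shows "(\<Sum>x\<in>{1..n} - Y. cover_prob N (insert x Y)) = (real N - real (card Y)) * cover_prob N Y"
  unfolding cover_prob_def
  by (rule sum_prob_insert_subset)
     (use assms in \<open>auto simp: card_prefix_set dest: prefix_set_subset[THEN subsetD]\<close>)

lemma cover_prob_top:
  assumes "\<pi> \<in> set_pmf D"
  shows "cover_prob N (prefix_set N \<pi>) = prefix_prob N (prefix_set N \<pi>)"
  unfolding cover_prob_def prefix_prob_def
proof (rule measure_pmf.prob_eq_AE)
  have "prefix_set N \<pi> = prefix_set N \<sigma>" if "\<sigma> \<in> set_pmf D" "prefix_set N \<pi> \<subseteq> prefix_set N \<sigma>" for \<sigma>
    using that assms by (intro card_subset_eq) (simp_all add: card_prefix_set, simp add: prefix_set_def)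
  then show "AE \<sigma> in D. prefix_set N \<pi> \<subseteq> prefix_set N \<sigma> \<longleftrightarrow> prefix_set N \<sigma> = prefix_set N \<pi>"
    by (fastforce simp: AE_measure_pmf_iff)
qed auto

lemma potential_top: "potential N N = 0"
proof -
  have "potential N N = E (\<lambda>_. 0)"
    unfolding potential_def
  proof (rule expectation_pmf_cong)
    fix \<pi> assume "\<pi> \<in> set_pmf D"
    then show "ln (cover_prob N (prefix_set N \<pi>) / prefix_prob N (prefix_set N \<pi>)) = 0"
      using prefix_prob_pos[of \<pi> N] by (simp add: cover_prob_top)
  qed
  then show ?thesis by simp
qed

lemma perm_entropy_eq: "perm_entropy n D = E (\<lambda>\<pi>. - ln (pmf D \<pi>))"
proof -
  have "E (\<lambda>\<pi>. - ln (pmf D \<pi>)) = (\<Sum>\<pi> | \<pi> permutes {1..n}. - ln (pmf D \<pi>) * pmf D \<pi>)"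
    by (rule integral_measure_pmf_real) (use support finite_permutations in auto)
  then show ?thesis
    by (simp add: perm_entropy_def sum_negf mult.commute)
qed

lemma potential_le_perm_entropy:
  assumes "i \<le> N"
  shows "potential N i \<le> perm_entropy n D"
  unfolding potential_def perm_entropy_eq
proof (rule expectation_pmf_mono[OF finite_support])
  fix \<pi> assume \<pi>: "\<pi> \<in> set_pmf D"
  have "pmf D \<pi> \<le> prefix_prob i (prefix_set i \<pi>)"
    unfolding prefix_prob_def pmf.rep_eq by (rule measure_pmf.finite_measure_mono) auto
  then have "ln (cover_prob N (prefix_set i \<pi>) / prefix_prob i (prefix_set i \<pi>)) \<le> ln (1 / pmf D \<pi>)"
    using cover_prob_pos[OF \<pi> assms] prefix_prob_pos[OF \<pi>, of i] pmf_positive[OF \<pi>]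
    by (intro ln_mono frac_le) (auto simp: cover_prob_le_1)
  then show "ln (cover_prob N (prefix_set i \<pi>) / prefix_prob i (prefix_set i \<pi>)) \<le> - ln (pmf D \<pi>)"
    using pmf_positive[OF \<pi>] by (simp add: ln_div)
qed

definition extension :: "nat \<Rightarrow> (nat \<Rightarrow> nat) \<Rightarrow> nat set \<times> nat" where
  "extension i \<pi> = (prefix_set i \<pi>, \<pi> (Suc i))"

text \<open>The density of \<open>(\<pi>[i], x)\<close> where \<open>x\<close> is drawn with probability proportional to
  \<open>cover_prob N (insert x \<pi>[i])\<close>.\<close>

definition extension_density :: "nat \<Rightarrow> nat \<Rightarrow> nat set \<times> nat \<Rightarrow> real" where
  "extension_density N i = (\<lambda>(Y, x).
     prefix_prob i Y * cover_prob N (insert x Y) / ((real N - real i) * cover_prob N Y))"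

lemma pmf_extension:
  assumes "\<pi> \<in> set_pmf D"
  shows "pmf (map_pmf (extension i) D) (extension i \<pi>)
    = last_prob (Suc i) (\<pi> (Suc i)) (prefix_set (Suc i) \<pi>)
      * prefix_prob (Suc i) (prefix_set (Suc i) \<pi>)"
proof -
  have "pmf (map_pmf (extension i) D) (extension i \<pi>)
      = \<P>(\<sigma> in D. prefix_set i \<sigma> = prefix_set i \<pi> \<and> \<sigma> (Suc i) = \<pi> (Suc i))"
    by (simp add: pmf_map vimage_def extension_def)
  also have "\<dots> = \<P>(\<sigma> in D. \<sigma> (Suc i) = \<pi> (Suc i) \<and> prefix_set (Suc i) \<sigma> = prefix_set (Suc i) \<pi>)"
  proof (rule measure_pmf.prob_eq_AE)
    have "prefix_set i \<sigma> = prefix_set i \<pi> \<and> \<sigma> (Suc i) = \<pi> (Suc i)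
        \<longleftrightarrow> \<sigma> (Suc i) = \<pi> (Suc i) \<and> prefix_set (Suc i) \<sigma> = prefix_set (Suc i) \<pi>"
      if "\<sigma> \<in> set_pmf D" for \<sigma>
      using next_notin_prefix_set[OF that, of i] next_notin_prefix_set[OF assms, of i]
      by (metis insert_ident prefix_set_Suc)
    then show "AE \<sigma> in D. prefix_set i \<sigma> = prefix_set i \<pi> \<and> \<sigma> (Suc i) = \<pi> (Suc i)
        \<longleftrightarrow> \<sigma> (Suc i) = \<pi> (Suc i) \<and> prefix_set (Suc i) \<sigma> = prefix_set (Suc i) \<pi>"
      by (simp add: AE_measure_pmf_iff)
  qed auto
  finally show ?thesis
    using prefix_prob_pos[OF assms, of "Suc i"]
    by (simp add: last_prob_def cond_prob_def prefix_prob_def)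
qed

lemma sum_extension_density_insert:
  assumes "i < N" and "N \<le> n" and "\<pi> \<in> set_pmf D" and "Y = prefix_set i \<pi>"
  shows "(\<Sum>x\<in>{1..n} - Y. extension_density N i (Y, x)) = prefix_prob i Y"
proof -
  have "(\<Sum>x\<in>{1..n} - Y. extension_density N i (Y, x))
      = prefix_prob i Y / ((real N - real i) * cover_prob N Y)
        * (\<Sum>x\<in>{1..n} - Y. cover_prob N (insert x Y))"
    by (simp add: extension_density_def sum_distrib_left)
  also have "(\<Sum>x\<in>{1..n} - Y. cover_prob N (insert x Y)) = (real N - real i) * cover_prob N Y"
    using sum_cover_prob_insert[of N Y] prefix_set_subset[of \<pi> i] assms
    by (simp add: card_prefix_set)
  finally show ?thesis
    using assms cover_prob_pos[of \<pi> i N] by simp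
qed

lemma sum_extension_density_le_1:
  assumes "i < N" and "N \<le> n"
  shows "sum (extension_density N i) (extension i ` set_pmf D) \<le> 1"
proof -
  define P where "P = prefix_set i ` set_pmf D"
  have "extension_density N i z \<ge> 0" for z
    using assms by (cases z) (simp add: extension_density_def cover_prob_nonneg prefix_prob_def)
  moreover have "extension i \<pi> \<in> (SIGMA Y:P. {1..n} - Y)" if "\<pi> \<in> set_pmf D" for \<pi>
    using that assms next_in_range[of \<pi> i] next_notin_prefix_set[of \<pi> i]
    by (simp add: extension_def P_def)
  then have "extension i ` set_pmf D \<subseteq> (SIGMA Y:P. {1..n} - Y)"
    by (rule image_subsetI)
  moreover have "finite P"
    using finite_support by (simp add: P_def)
  ultimately have "sum (extension_density N i) (extension i ` set_pmf D)
      \<le> sum (extension_density N i) (SIGMA Y:P. {1..n} - Y)"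
    by (intro sum_mono2) auto
  also have "\<dots> = (\<Sum>Y\<in>P. \<Sum>x\<in>{1..n} - Y. extension_density N i (Y, x))"
    using \<open>finite P\<close> by (simp add: sum.Sigma)
  also have "\<dots> = (\<Sum>Y\<in>P. prefix_prob i Y)"
    using assms sum_extension_density_insert by (intro sum.cong) (auto simp: P_def)
  also have "\<dots> = 1"
    by (simp add: P_def sum_prefix_prob)
  finally show ?thesis .
qed

lemma extension_density_pos:
  assumes "i < N" and "\<pi> \<in> set_pmf D"
  shows "extension_density N i (extension i \<pi>) > 0"
  using assms prefix_prob_pos[of \<pi> i] cover_prob_pos[of \<pi> i N] cover_prob_pos[of \<pi> "Suc i" N]
  by (simp add: extension_density_def extension_def prefix_set_Suc)

lemma potential_step:
  assumes "i < N" and "N \<le> n"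
  shows "potential N (Suc i)
      - E (\<lambda>\<pi>. ln ((real N - real i) * last_prob (Suc i) (\<pi> (Suc i)) (prefix_set (Suc i) \<pi>)))
    \<le> potential N i"
proof -
  let ?p = "map_pmf (extension i) D"
  let ?density = "\<lambda>\<pi>. extension_density N i (extension i \<pi>)"
  let ?ratio = "\<lambda>i \<pi>. cover_prob N (prefix_set i \<pi>) / prefix_prob i (prefix_set i \<pi>)"
  let ?q = "\<lambda>\<pi>. (real N - real i) * last_prob (Suc i) (\<pi> (Suc i)) (prefix_set (Suc i) \<pi>)"
  have "measure_pmf.expectation ?p (\<lambda>z. ln (extension_density N i z))
      \<le> measure_pmf.expectation ?p (\<lambda>z. ln (pmf ?p z))"
    using assms finite_support
    by (intro gibbs_inequality_pmf) (auto simp: extension_density_pos sum_extension_density_le_1)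
  then have "E (\<lambda>\<pi>. ln (?density \<pi>) - ln (pmf ?p (extension i \<pi>))) \<le> 0"
    by simp
  also have "E (\<lambda>\<pi>. ln (?density \<pi>) - ln (pmf ?p (extension i \<pi>)))
      = E (\<lambda>\<pi>. ln (?ratio (Suc i) \<pi>) - ln (?q \<pi>) - ln (?ratio i \<pi>))"
  proof (rule expectation_pmf_cong)
    fix \<pi> assume \<pi>: "\<pi> \<in> set_pmf D"
    note pos = prefix_prob_pos[OF \<pi>, of i] prefix_prob_pos[OF \<pi>, of "Suc i"]
      cover_prob_pos[OF \<pi>, of i N] cover_prob_pos[OF \<pi>, of "Suc i" N]
      last_prob_pos[OF \<pi>, of "Suc i"]
    have "?density \<pi> = prefix_prob i (prefix_set i \<pi>) * cover_prob N (prefix_set (Suc i) \<pi>)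
        / ((real N - real i) * cover_prob N (prefix_set i \<pi>))"
      by (simp add: extension_density_def extension_def prefix_set_Suc)
    then show "ln (?density \<pi>) - ln (pmf ?p (extension i \<pi>))
        = ln (?ratio (Suc i) \<pi>) - ln (?q \<pi>) - ln (?ratio i \<pi>)"
      using pos assms(1) by (simp add: pmf_extension[OF \<pi>] ln_mult ln_div)
  qed
  also have "\<dots> = potential N (Suc i) - E (\<lambda>\<pi>. ln (?q \<pi>)) - potential N i"
    by (simp add: potential_def)
  finally show ?thesis by simp
qed

lemma potential_step_hit_prob:
  assumes "i < N" and "N \<le> n"
  shows "potential N (Suc i) + 2 - 3 * (real N - real i) * hit_prob (Suc i) \<le> potential N i"
proof -
  let ?last = "\<lambda>\<pi>. last_prob (Suc i) (\<pi> (Suc i)) (prefix_set (Suc i) \<pi>)"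
  have "E (\<lambda>\<pi>. ln ((real N - real i) * ?last \<pi>)) \<le> E (\<lambda>\<pi>. 3 * (real N - real i) * ?last \<pi> - 2)"
  proof (rule expectation_pmf_mono[OF finite_support])
    fix \<pi> assume "\<pi> \<in> set_pmf D"
    then have pos: "(real N - real i) * ?last \<pi> > 0"
      using assms(1) by (simp add: last_prob_pos)
    have "ln ((real N - real i) * ?last \<pi>) \<le> exp 1 * ((real N - real i) * ?last \<pi>) - 2"
      using ln_le_tangent[OF pos, of 1] by simp
    also have "\<dots> \<le> 3 * ((real N - real i) * ?last \<pi>) - 2"
      using pos exp_le by (intro diff_right_mono mult_right_mono) auto
    finally show "ln ((real N - real i) * ?last \<pi>) \<le> 3 * (real N - real i) * ?last \<pi> - 2"
      by (simp only: mult.assoc)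
  qed
  also have "\<dots> = 3 * (real N - real i) * hit_prob (Suc i) - 2"
    by (simp add: hit_prob_def)
  finally show ?thesis
    using potential_step[OF assms] by linarith
qed

lemma potential_ge:
  assumes "i \<le> N" and "N \<le> n"
  shows "(real N - real i) * (2 - 3 * (\<Sum>j\<in>{i<..N}. hit_prob j)) \<le> potential N i"
  using assms(1)
proof (induction rule: inc_induct)
  case base
  show ?case by (simp add: potential_top)
next
  case (step i)
  define S where "S = (\<Sum>j\<in>{Suc i<..N}. hit_prob j)"
  have "{i<..N} = insert (Suc i) {Suc i<..N}"
    using step.hyps by auto
  then have sum_split: "(\<Sum>j\<in>{i<..N}. hit_prob j) = hit_prob (Suc i) + S"
    by (simp add: S_def)
  have "S \<ge> 0"
    by (simp add: S_def sum_nonneg hit_prob_nonneg)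
  then have "(real N - real i) * (2 - 3 * (hit_prob (Suc i) + S))
      \<le> (real N - real (Suc i)) * (2 - 3 * S) + 2 - 3 * (real N - real i) * hit_prob (Suc i)"
    by (simp add: algebra_simps)
  also have "\<dots> \<le> potential N (Suc i) + 2 - 3 * (real N - real i) * hit_prob (Suc i)"
    using step.IH by (simp add: S_def)
  also have "\<dots> \<le> potential N i"
    using step.hyps assms(2) by (intro potential_step_hit_prob) auto
  finally show ?case
    by (simp only: sum_split)
qed

lemma perm_entropy_ge_window:
  assumes "i + k \<le> n"
  shows "real k * (2 - 3 * (\<Sum>j\<in>{i<..i + k}. hit_prob j)) \<le> perm_entropy n D"
  using potential_ge[of i "i + k"] potential_le_perm_entropy[of i "i + k"] assms by simp

lemma sum_hit_prob_le:
  assumes "backwards_efficient n \<alpha> D"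
  shows "(\<Sum>i=1..n. real i * hit_prob i) \<le> \<alpha> * real n"
proof -
  define c where "c = (\<lambda>x Y. real (card Y) * last_prob (card Y) x Y)"
  have "measure_pmf.expectation (pmf_of_set Y) (\<lambda>x. c x Y) \<le> 1" if "Y \<subseteq> {1..n}" "Y \<noteq> {}" for Y
  proof -
    have "finite Y"
      using that finite_subset by blast
    then have "measure_pmf.expectation (pmf_of_set Y) (\<lambda>x. c x Y) = (\<Sum>x\<in>Y. last_prob (card Y) x Y)"
      using that by (simp add: integral_pmf_of_set c_def sum_distrib_left[symmetric])
    then show ?thesis
      using \<open>finite Y\<close> by (simp add: last_prob_def sum_cond_prob_le_1)
  qed
  then have "E (total_cost n c) \<le> \<alpha> * real n"
    using assms unfolding backwards_efficient_def by blast
  moreover have "E (total_cost n c) = E (\<lambda>\<pi>. \<Sum>i=1..n. real i * last_prob i (\<pi> i) (prefix_set i \<pi>))"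
    unfolding total_cost_def c_def prefix_set_def[symmetric]
    by (rule expectation_pmf_cong) (simp add: card_prefix_set)
  ultimately show ?thesis
    by (simp add: hit_prob_def)
qed

lemma perm_entropy_ge_if_backwards_efficient:
  assumes "n \<ge> 1" and "backwards_efficient n \<alpha> D" and k_le: "24 * (real k * \<alpha>) \<le> real n"
  shows "real k \<le> perm_entropy n D"
proof (cases "k = 0")
  case True
  then show ?thesis
    using perm_entropy_ge_window[of 0 0] by simp
next
  case False
  have "real k * 1 \<le> real k * \<alpha>"
    using backwards_efficient_imp_ge_1[OF assms(1,2)] by (intro mult_left_mono) auto
  then have "k > 0" "4 * k \<le> n"
    using False k_le by linarith+
  then obtain i where window: "i + k \<le> n" "real n * (\<Sum>j\<in>{i<..i + k}. hit_prob j) \<le> 8 * real k * \<alpha>"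
    using exists_light_window[OF hit_prob_nonneg sum_hit_prob_le[OF assms(2)]] by blast
  have "real n * (\<Sum>j\<in>{i<..i + k}. hit_prob j) \<le> real n * (1 / 3)"
    using window(2) k_le by linarith
  then have "(\<Sum>j\<in>{i<..i + k}. hit_prob j) \<le> 1 / 3"
    using assms(1) by simp
  then have "real k * 1 \<le> real k * (2 - 3 * (\<Sum>j\<in>{i<..i + k}. hit_prob j))"
    by (intro mult_left_mono) auto
  also have "\<dots> \<le> perm_entropy n D"
    using window(1) by (rule perm_entropy_ge_window)
  finally show ?thesis by simp
qed

end

theorem theorem1:
  fixes n :: nat and \<alpha> :: real and D :: "(nat \<Rightarrow> nat) pmf"
  assumes "n \<ge> 1" and "\<alpha> > 0"
    and "set_pmf D \<subseteq> {\<pi>. \<pi> permutes {1..n}}"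
    and "backwards_efficient n \<alpha> D"
  shows "perm_entropy n D \<ge> real_of_int \<lfloor>real n / (48 * \<alpha>)\<rfloor>"
proof -
  interpret permutation_pmf n D by unfold_locales (rule assms(3))
  define k where "k = nat \<lfloor>real n / (48 * \<alpha>)\<rfloor>"
  have floor_eq: "real_of_int \<lfloor>real n / (48 * \<alpha>)\<rfloor> = real k"
    using assms(2) by (simp add: k_def)
  then have "real k \<le> real n / (48 * \<alpha>)"
    by linarith
  then have "48 * (real k * \<alpha>) \<le> real n"
    using assms(2) by (simp add: field_simps)
  moreover have "0 \<le> real k * \<alpha>"
    using assms(2) by simp
  ultimately have "24 * (real k * \<alpha>) \<le> real n"
    by linarith
  then have "real k \<le> perm_entropy n D"
    by (rule perm_entropy_ge_if_backwards_efficient[OF assms(1,4)])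
  then show ?thesis
    by (simp only: floor_eq)
qed

end
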